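(* Let $\alpha\in(0,1)$ and $\tau_0>0$. If a fuzzy function $\mathfrak{w}:[0,\infty)\to\mathcal{F}$ is $\alpha_{gH}$-differentiable at $\tau_0$ (with base point $0$), then $\mathfrak{w}$ is fuzzy continuous at $\tau_0$.
   Context: A fuzzy number is a map $\mathcal{P}:\mathbb{R}\to[0,1]$ that is normal, fuzzy convex, upper semicontinuous and compactly supported; $\mathcal{F}$ is the set of fuzzy numbers and $\Omega\subset\mathcal{F}$ the set of triangular fuzzy numbers. For $r\in(0,1]$, $[\mathcal{P}]^r=\{x:\mathcal{P}(x)\ge r\}$, and $[\mathcal{P}]^0=\overline{\{x:\mathcal{P}(x)>0\}}$; each $[\mathcal{P}]^r=[\mathcal{P}_1(r),\mathcal{P}_2(r)]$ is a compact interval. Addition $\oplus$ and multiplication by real scalars are levelwise: $[\mathcal{P}\oplus\mathcal{Q}]^r=[\mathcal{P}]^r+[\mathcal{Q}]^r$, $[c\,\mathcal{P}]^r=c[\mathcal{P}]^r$. The generalized Hukuhara difference $\mathcal{P}\ominus_{gH}\mathcal{Q}$ is the fuzzy number $\mathcal{R}$ (if it exists) such that $\mathcal{P}=\mathcal{Q}\oplus\mathcal{R}$ or $\mathcal{Q}=\mathcal{P}\oplus(-1)\mathcal{R}$. Standing assumption: the gH-differences that occur exist and belong to $\Omega$. Limits are taken in the Hausdorff metric $D(\mathcal{P},\mathcal{Q})=\sup_{r\in[0,1]}\max\{|\mathcal{P}_1(r)-\mathcal{Q}_1(r)|,|\mathcal{P}_2(r)-\mathcal{Q}_2(r)|\}$;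 $\mathfrak{w}$ is fuzzy continuous at $\tau_0$ if $\lim_{\tau\to\tau_0}\mathfrak{w}(\tau)=\mathfrak{w}(\tau_0)$. $\mathfrak{w}$ is $\alpha_{gH}$-differentiable at $\tau_0$ (base point $0$) if the limit $${}_{gH}\mathbf{T}^{0}_{\alpha}(\mathfrak{w}(\tau_0))=\lim_{\epsilon\to0}\frac{\mathfrak{w}(\tau_0+\epsilon\tau_0^{1-\alpha})\ominus_{gH}\mathfrak{w}(\tau_0)}{\epsilon}$$ exists in $\mathcal{F}$. *)

theory Defs
  imports "HOL-Analysis.Analysis"
begin

definition is_fuzzy_number :: "(real \<Rightarrow> real) \<Rightarrow> bool" where
  "is_fuzzy_number P \<longleftrightarrow>
     range P \<subseteq> {0..1} \<and>
     (\<exists>x. P x = 1) \<and>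
     (\<forall>x y. \<forall>t\<in>{0..1}. min (P x) (P y) \<le> P (t * x + (1 - t) * y)) \<and>
     (\<forall>a. open {x. P x < a}) \<and>
     compact (closure {x. 0 < P x})"

typedef fuzzy = "{P. is_fuzzy_number P}" morphisms mem Fuzzy
proof
  have "{x::real. (if x = 0 then 1 else 0::real) < a} =
      (if a \<le> 0 then {} else if a \<le> 1 then - {0} else UNIV)" for a :: real
    by auto
  then have "open {x::real. (if x = 0 then 1 else 0::real) < a}" for a :: real
    by (simp add: open_Compl)
  then have "is_fuzzy_number (\<lambda>x. if x = 0 then 1 else 0)"
    by (auto simp: is_fuzzy_number_def)
  then show "(\<lambda>x. if x = 0 then 1 else 0) \<in> {P. is_fuzzy_number P}" by simp
qed

definition lev :: "fuzzy \<Rightarrow> real \<Rightarrow> real set" where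
  "lev P r = (if r = 0 then closure {x. 0 < mem P x} else {x. r \<le> mem P x})"

text \<open>Endpoints of the level sets, see \<open>lev_eq\<close> below.\<close>

definition lo :: "fuzzy \<Rightarrow> real \<Rightarrow> real" where
  "lo P r = Inf (lev P r)"

definition hi :: "fuzzy \<Rightarrow> real \<Rightarrow> real" where
  "hi P r = Sup (lev P r)"

text \<open>The operations are determined by their level sets; that such fuzzy numbers exist and are
  unique is shown in \<open>lev_add\<close>, \<open>lev_scale\<close> and \<open>gH_diff_eqI\<close> below.\<close>

definition fuzzy_add :: "fuzzy \<Rightarrow> fuzzy \<Rightarrow> fuzzy" (infixl "\<oplus>" 65) where
  "P \<oplus> Q = (THE R. \<forall>r\<in>{0..1}. lev R r = {x + y | x y. x \<in> lev P r \<and> y \<in> lev Q r})"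

definition fuzzy_scale :: "real \<Rightarrow> fuzzy \<Rightarrow> fuzzy" (infixr "\<odot>" 75) where
  "c \<odot> P = (THE R. \<forall>r\<in>{0..1}. lev R r = (\<lambda>x. c * x) ` lev P r)"

definition is_gH_diff :: "fuzzy \<Rightarrow> fuzzy \<Rightarrow> fuzzy \<Rightarrow> bool" where
  "is_gH_diff P Q R \<longleftrightarrow> P = Q \<oplus> R \<or> Q = P \<oplus> (-1) \<odot> R"

definition gH_diff :: "fuzzy \<Rightarrow> fuzzy \<Rightarrow> fuzzy" (infixl "\<ominus>\<^sub>g\<^sub>H" 65) where
  "P \<ominus>\<^sub>g\<^sub>H Q = (THE R. is_gH_diff P Q R)"

text \<open>Triangular fuzzy numbers \<open>(a, b, c)\<close> with \<open>a \<le> b \<le> c\<close>; the degenerate cases \<open>a = b\<close>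
  and \<open>b = c\<close> (in particular crisp numbers) are included.\<close>

definition triangular :: "fuzzy set" where
  "triangular = {P. \<exists>a b c. a \<le> b \<and> b \<le> c \<and>
     (\<forall>x. mem P x =
        (if x = b then 1
         else if a < x \<and> x < b then (x - a) / (b - a)
         else if b < x \<and> x < c then (c - x) / (c - b)
         else 0))}"

lemma fuzzy_number_mem: "is_fuzzy_number (mem P)"
  using mem by auto

lemma mem_bounds: "0 \<le> mem P x" "mem P x \<le> 1"
  using fuzzy_number_mem[of P] unfolding is_fuzzy_number_def by force+

lemma lev_antimono:
  assumes "0 \<le> r" "r \<le> s"
  shows "lev P s \<subseteq> lev P r"
proof (cases "r = 0")
  case True
  have "{x. 0 < mem P x} \<subseteq> closure {x. 0 < mem P x}" by (rule closure_subset)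
  then show ?thesis using True assms by (auto simp: lev_def)
qed (use assms in \<open>auto simp: lev_def\<close>)

lemma closed_lev: "closed (lev P r)"
proof (cases "r = 0")
  case False
  have "open {x. mem P x < r}" using fuzzy_number_mem[of P] by (simp add: is_fuzzy_number_def)
  moreover have "lev P r = - {x. mem P x < r}" using False by (auto simp: lev_def)
  ultimately show ?thesis by (simp add: closed_def)
qed (simp add: lev_def)

lemma compact_lev:
  assumes "0 \<le> r"
  shows "compact (lev P r)"
proof -
  have "compact (lev P 0)" using fuzzy_number_mem[of P] by (simp add: is_fuzzy_number_def lev_def)
  moreover have "lev P r = lev P 0 \<inter> lev P r" using lev_antimono[of 0 r] assms by auto
  ultimately show ?thesis using closed_lev compact_Int_closed by metis
qed

lemma lev_nonempty:
  assumes "0 \<le> r" "r \<le> 1"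
  shows "lev P r \<noteq> {}"
proof -
  obtain x where "mem P x = 1" using fuzzy_number_mem[of P] by (auto simp: is_fuzzy_number_def)
  then have "x \<in> lev P 1" by (simp add: lev_def)
  then show ?thesis using lev_antimono[OF assms] by blast
qed

lemma convex_lev: "convex (lev P r)"
proof -
  have *: "min (mem P x) (mem P y) \<le> mem P (u * x + v * y)"
    if "0 \<le> u" "0 \<le> v" "u + v = 1" for x y u v
  proof -
    have "v = 1 - u" "u \<in> {0..1}" using that by auto
    then show ?thesis using fuzzy_number_mem[of P] unfolding is_fuzzy_number_def by blast
  qed
  have "convex {x. 0 < mem P x}"
  proof (rule convexI)
    fix x y u v :: real
    assume "x \<in> {x. 0 < mem P x}" "y \<in> {x. 0 < mem P x}" and uv: "0 \<le> u" "0 \<le> v" "u + v = 1"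
    then show "u *\<^sub>R x + v *\<^sub>R y \<in> {x. 0 < mem P x}"
      using *[OF uv, of x y] by auto
  qed
  moreover have "convex {x. r \<le> mem P x}"
  proof (rule convexI)
    fix x y u v :: real
    assume "x \<in> {x. r \<le> mem P x}" "y \<in> {x. r \<le> mem P x}" and uv: "0 \<le> u" "0 \<le> v" "u + v = 1"
    then show "u *\<^sub>R x + v *\<^sub>R y \<in> {x. r \<le> mem P x}"
      using *[OF uv, of x y] by auto
  qed
  ultimately show ?thesis by (simp add: lev_def convex_closure)
qed

lemma lev_eq:
  assumes "0 \<le> r" "r \<le> 1"
  shows "lev P r = {lo P r..hi P r}" "lo P r \<le> hi P r"
proof -
  have "connected (lev P r)" by (simp add: convex_connected convex_lev)
  then obtain a b where ab: "lev P r = {a..b}"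
    using compact_lev[OF assms(1)] connected_compact_interval_1 by (metis cbox_interval)
  then have "a \<le> b" using lev_nonempty[OF assms, of P] by auto
  then show "lev P r = {lo P r..hi P r}" "lo P r \<le> hi P r" using ab by (auto simp: lo_def hi_def)
qed

lemma lev_zero_eq: "lev P 0 = closure (\<Union>r\<in>{0<..1}. lev P r)"
proof -
  have "{x. 0 < mem P x} = (\<Union>r\<in>{0<..1}. lev P r)"
    using mem_bounds[of P] by (fastforce simp: lev_def)
  then show ?thesis by (simp add: lev_def)
qed

lemma lev_left:
  assumes "0 < r" "\<And>s. 0 < s \<Longrightarrow> s < r \<Longrightarrow> x \<in> lev P s"
  shows "x \<in> lev P r"
proof -
  have "r \<le> mem P x"
  proof (rule ccontr)
    assume "\<not> r \<le> mem P x"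
    then obtain s where "mem P x < s" "s < r" using dense not_le by metis
    moreover have "0 < s" using calculation mem_bounds[of P x] by linarith
    ultimately show False using assms(2)[of s] by (simp add: lev_def)
  qed
  then show ?thesis using assms(1) by (simp add: lev_def)
qed

lemma fuzzy_eqI:
  assumes "\<And>r. 0 \<le> r \<Longrightarrow> r \<le> 1 \<Longrightarrow> lev P r = lev Q r"
  shows "P = Q"
proof -
  have le: "mem P x \<le> mem Q x"
    if "\<And>r. 0 \<le> r \<Longrightarrow> r \<le> 1 \<Longrightarrow> lev P r = lev Q r" for P Q x
  proof (cases "mem P x = 0")
    case False
    then have "x \<in> lev P (mem P x)" by (simp add: lev_def)
    then have "x \<in> lev Q (mem P x)" using that mem_bounds by blast
    then show ?thesis using False by (simp add: lev_def)
  qed (simp add: mem_bounds)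
  have "mem P = mem Q"
  proof
    fix x
    have "mem P x \<le> mem Q x" by (rule le) (rule assms)
    moreover have "mem Q x \<le> mem P x" by (rule le) (rule assms[symmetric])
    ultimately show "mem P x = mem Q x" by (rule antisym)
  qed
  then show ?thesis by (simp add: mem_inject)
qed

lemma fuzzy_eqI':
  assumes "\<And>r. 0 \<le> r \<Longrightarrow> r \<le> 1 \<Longrightarrow> lo P r = lo Q r" "\<And>r. 0 \<le> r \<Longrightarrow> r \<le> 1 \<Longrightarrow> hi P r = hi Q r"
  shows "P = Q"
  using assms by (intro fuzzy_eqI) (simp add: lev_eq)

lemma fuzzy_of_levels:
  assumes co: "\<And>r. 0 \<le> r \<Longrightarrow> r \<le> 1 \<Longrightarrow> compact (A r)"
    and cv: "\<And>r. 0 \<le> r \<Longrightarrow> r \<le> 1 \<Longrightarrow> convex (A r)"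
    and ne: "A 1 \<noteq> {}"
    and am: "\<And>r s. 0 \<le> r \<Longrightarrow> r \<le> s \<Longrightarrow> s \<le> 1 \<Longrightarrow> A s \<subseteq> A r"
    and left: "\<And>r x. 0 < r \<Longrightarrow> r \<le> 1 \<Longrightarrow> (\<And>s. 0 < s \<Longrightarrow> s < r \<Longrightarrow> x \<in> A s) \<Longrightarrow> x \<in> A r"
    and zero: "A 0 = closure (\<Union>r\<in>{0<..1}. A r)"
  shows "\<exists>R. \<forall>r\<in>{0..1}. lev R r = A r"
proof -
  define S where "S x = insert 0 {r. 0 < r \<and> r \<le> 1 \<and> x \<in> A r}" for x
  define f where "f x = Sup (S x)" for x
  have bdd: "bdd_above (S x)" for x by (auto simp: S_def intro: bdd_aboveI[of _ 1])
  have upper: "r \<le> f x" if "r \<in> S x" for r x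
    using that bdd unfolding f_def by (simp add: cSup_upper)
  have f_ge: "r \<le> f x \<longleftrightarrow> x \<in> A r" if r: "0 < r" "r \<le> 1" for r x
  proof
    assume *: "r \<le> f x"
    show "x \<in> A r"
    proof (rule left[OF r])
      fix s assume s: "0 < s" "s < r"
      then have "s < Sup (S x)" using * by (simp add: f_def)
      then obtain t where "t \<in> S x" "s < t" using bdd less_cSup_iff[of "S x" s] by (auto simp: S_def)
      then show "x \<in> A s" using am[of s t] s by (auto simp: S_def)
    qed
  next
    assume "x \<in> A r"
    then show "r \<le> f x" using upper r by (simp add: S_def)
  qed
  have f0: "0 \<le> f x" for x by (rule upper) (simp add: S_def)
  have f1: "f x \<le> 1" for x unfolding f_def by (rule cSup_least) (auto simp: S_def)
  have pos: "{x. 0 < f x} = (\<Union>r\<in>{0<..1}. A r)"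
  proof (intro set_eqI iffI)
    fix x assume "x \<in> {x. 0 < f x}"
    then show "x \<in> (\<Union>r\<in>{0<..1}. A r)" using f_ge[of "f x" x] f1[of x] by auto
  next
    fix x assume "x \<in> (\<Union>r\<in>{0<..1}. A r)"
    then obtain r where "0 < r" "r \<le> 1" "x \<in> A r" by auto
    then show "x \<in> {x. 0 < f x}" using f_ge[of r x] by auto
  qed
  have "is_fuzzy_number f"
    unfolding is_fuzzy_number_def
  proof (intro conjI allI ballI)
    show "range f \<subseteq> {0..1}" using f0 f1 by auto
    obtain x where "x \<in> A 1" using ne by auto
    then show "\<exists>x. f x = 1" using f_ge[of 1 x] f1[of x] by (auto intro: antisym)
    show "min (f x) (f y) \<le> f (t * x + (1 - t) * y)" if t: "t \<in> {0..1}" for x y t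
    proof (cases "min (f x) (f y) \<le> 0")
      case True
      then show ?thesis using f0[of "t * x + (1 - t) * y"] by linarith
    next
      case False
      define m where "m = min (f x) (f y)"
      have m: "0 < m" "m \<le> 1" "m \<le> f x" "m \<le> f y"
        using False f1[of x] by (auto simp: m_def)
      then have "x \<in> A m" "y \<in> A m" using f_ge by auto
      then have "t *\<^sub>R x + (1 - t) *\<^sub>R y \<in> A m"
        using cv[of m] m t unfolding convex_def by auto
      then show ?thesis using f_ge m by (simp add: m_def)
    qed
    show "open {x. f x < a}" for a
    proof (cases "0 < a \<and> a \<le> 1")
      case True
      then have "{x. f x < a} = - A a" using f_ge[of a] by force
      then show ?thesis using co[of a] True by (simp add: compact_imp_closed open_Compl)
    next
      case False
      have "{x. f x < a} = {} \<or> {x. f x < a} = UNIV"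
      proof (cases "a \<le> 0")
        case True
        then have "\<not> f x < a" for x using f0[of x] by linarith
        then show ?thesis by simp
      next
        case F2: False
        then have "f x < a" for x using f1[of x] False by linarith
        then show ?thesis by simp
      qed
      then show ?thesis by auto
    qed
    show "compact (closure {x. 0 < f x})" using pos zero co[of 0] by simp
  qed
  then have mem: "mem (Fuzzy f) = f" by (simp add: Fuzzy_inverse)
  have "lev (Fuzzy f) r = A r" if "r \<in> {0..1}" for r
    using that pos zero f_ge[of r] by (auto simp: lev_def mem)
  then show ?thesis by blast
qed

lemma lev_add:
  assumes "0 \<le> r" "r \<le> 1"
  shows "lev (P \<oplus> Q) r = {x + y | x y. x \<in> lev P r \<and> y \<in> lev Q r}"
proof -
  define A where "A r = {x + y | x y. x \<in> lev P r \<and> y \<in> lev Q r}" for r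
  have "\<exists>R. \<forall>r\<in>{0..1}. lev R r = A r"
  proof (rule fuzzy_of_levels)
    show co: "compact (A r)" if "0 \<le> r" "r \<le> 1" for r
      unfolding A_def using that by (simp add: compact_sums compact_lev)
    show "convex (A r)" for r
    proof -
      have "A r = (\<Union>x\<in>lev P r. \<Union>y\<in>lev Q r. {x + y})" by (auto simp: A_def)
      then show ?thesis by (simp add: convex_sums convex_lev)
    qed
    show "A 1 \<noteq> {}" using lev_nonempty[of 1 P] lev_nonempty[of 1 Q] by (fastforce simp: A_def)
    show am: "A s \<subseteq> A r" if "0 \<le> r" "r \<le> s" for r s
      using lev_antimono[OF that] by (fastforce simp: A_def)
    show "x \<in> A r" if r: "0 < r" "r \<le> 1" and x: "\<And>s. 0 < s \<Longrightarrow> s < r \<Longrightarrow> x \<in> A s" for r x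
    proof -
      define s where "s n = r * (1 - 1 / (real n + 2))" for n
      have s: "0 < s n" "s n < r" for n
        using r by (auto simp: s_def field_simps intro!: add_pos_nonneg)
      have smono: "s m \<le> s n" if "m \<le> n" for m n
        using r that unfolding s_def by (intro mult_left_mono) (auto simp: field_simps)
      define F where "F n = lev P (s n) \<inter> (\<lambda>y. x - y) ` lev Q (s n)" for n
      have "\<Inter>(range F) \<noteq> {}"
      proof (rule compact_nest)
        show "compact (F n)" for n
          unfolding F_def using s[of n]
          by (intro compact_Int compact_continuous_image continuous_intros compact_lev) auto
        show "F n \<noteq> {}" for n
          using x[OF s, of n] by (force simp: F_def A_def)
        show "F n \<subseteq> F m" if "m \<le> n" for m n
          using lev_antimono[of "s m" "s n"] smono[OF that] s[of m] by (fastforce simp: F_def)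
      qed
      then obtain p where p: "\<And>n. p \<in> F n" by auto
      have ex: "\<exists>n. t < s n" if "t < r" for t
      proof -
        obtain n where "r / (r - t) < real n" using reals_Archimedean2 by blast
        then have "r < real n * (r - t)" using that by (simp add: pos_divide_less_eq)
        also have "\<dots> \<le> (real n + 2) * (r - t)" using that by (intro mult_right_mono) auto
        finally have "t < s n" by (simp add: s_def field_simps)
        then show ?thesis by blast
      qed
      have "p \<in> lev P r" "x - p \<in> lev Q r"
      proof (rule_tac [!] lev_left[OF r(1)])
        fix t assume t: "0 < t" "t < r"
        then obtain n where n: "t < s n" using ex by blast
        then show "p \<in> lev P t" using p[of n] lev_antimono[of t "s n" P] t by (auto simp: F_def)
        show "x - p \<in> lev Q t" using n p[of n] lev_antimono[of t "s n" Q] t by (auto simp: F_def)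
      qed
      then show "x \<in> A r" unfolding A_def by force
    qed
    show "A 0 = closure (\<Union>r\<in>{0<..1}. A r)"
    proof
      have cA: "closed (A 0)" using co[of 0] by (simp add: compact_imp_closed)
      show "closure (\<Union>r\<in>{0<..1}. A r) \<subseteq> A 0"
        by (intro closure_minimal[OF _ cA] UN_least am) auto
      let ?SP = "\<Union>r\<in>{0<..1}. lev P r" and ?SQ = "\<Union>r\<in>{0<..1}. lev Q r"
      have "A 0 = closure ?SP + closure ?SQ"
        by (auto simp: A_def set_plus_def lev_zero_eq)
      also have "\<dots> \<subseteq> closure (?SP + ?SQ)" by (rule closure_sum)
      also have "?SP + ?SQ \<subseteq> (\<Union>r\<in>{0<..1}. A r)"
      proof
        fix z assume "z \<in> ?SP + ?SQ"
        then obtain x y r t where z: "z = x + y" "x \<in> lev P r" "y \<in> lev Q t"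
          "0 < r" "r \<le> 1" "0 < t" "t \<le> 1" by (auto simp: set_plus_def)
        then have "x \<in> lev P (min r t)" "y \<in> lev Q (min r t)"
          using lev_antimono[of "min r t" r P] lev_antimono[of "min r t" t Q] by auto
        then have "z \<in> A (min r t)" using z by (auto simp: A_def)
        moreover have "min r t \<in> {0<..1}" using z by auto
        ultimately show "z \<in> (\<Union>r\<in>{0<..1}. A r)" by blast
      qed
      finally show "A 0 \<subseteq> closure (\<Union>r\<in>{0<..1}. A r)" by (simp add: closure_mono)
    qed
  qed
  then have "\<exists>!R. \<forall>r\<in>{0..1}. lev R r = {x + y | x y. x \<in> lev P r \<and> y \<in> lev Q r}"
    unfolding A_def by (auto intro!: fuzzy_eqI)
  from theI'[OF this] show ?thesis using assms unfolding fuzzy_add_def by simp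
qed

lemma lev_scale:
  assumes "0 \<le> r" "r \<le> 1"
  shows "lev (c \<odot> P) r = (\<lambda>x. c * x) ` lev P r"
proof -
  define A where "A r = (\<lambda>x. c * x) ` lev P r" for r
  have "\<exists>R. \<forall>r\<in>{0..1}. lev R r = A r"
  proof (rule fuzzy_of_levels)
    show "compact (A r)" if "0 \<le> r" "r \<le> 1" for r
      unfolding A_def using that
      by (intro compact_continuous_image continuous_intros compact_lev)
    show "convex (A r)" for r
      unfolding A_def using convex_scaling[OF convex_lev, of c P r] by simp
    show "A 1 \<noteq> {}" using lev_nonempty[of 1] by (auto simp: A_def)
    show "A s \<subseteq> A r" if "0 \<le> r" "r \<le> s" for r s
      using lev_antimono[OF that] by (fastforce simp: A_def)
    show "x \<in> A r" if r: "0 < r" "r \<le> 1" and x: "\<And>s. 0 < s \<Longrightarrow> s < r \<Longrightarrow> x \<in> A s" for r x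
    proof (cases "c = 0")
      case True
      then have "x = 0" using x[of "r / 2"] r by (auto simp: A_def)
      then show ?thesis using True lev_nonempty[of r P] r by (auto simp: A_def)
    next
      case False
      have "x / c \<in> lev P r"
        proof (rule lev_left[OF r(1)])
        fix s assume "0 < s" "s < r"
        then obtain y where "y \<in> lev P s" "x = c * y" using x[of s] by (auto simp: A_def)
        then show "x / c \<in> lev P s" using False by simp
      qed
      then show ?thesis using False by (force simp: A_def)
    qed
    have "A 0 = (\<lambda>x. c *\<^sub>R x) ` closure (\<Union>r\<in>{0<..1}. lev P r)"
      by (simp add: A_def lev_zero_eq)
    also have "\<dots> = closure ((\<lambda>x. c *\<^sub>R x) ` (\<Union>r\<in>{0<..1}. lev P r))"
      by (rule closure_scaleR)
    also have "(\<lambda>x. c *\<^sub>R x) ` (\<Union>r\<in>{0<..1}. lev P r) = (\<Union>r\<in>{0<..1}. A r)"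
      by (auto simp: A_def)
    finally show "A 0 = closure (\<Union>r\<in>{0<..1}. A r)" .
  qed
  then have "\<exists>!R. \<forall>r\<in>{0..1}. lev R r = (\<lambda>x. c * x) ` lev P r"
    unfolding A_def by (auto intro!: fuzzy_eqI)
  from theI'[OF this] show ?thesis using assms unfolding fuzzy_scale_def by simp
qed

lemma endpoints_add:
  assumes "0 \<le> r" "r \<le> 1"
  shows "lo (P \<oplus> Q) r = lo P r + lo Q r" "hi (P \<oplus> Q) r = hi P r + hi Q r"
proof -
  note P = lev_eq[OF assms, of P] and Q = lev_eq[OF assms, of Q]
  have "lev (P \<oplus> Q) r = {lo P r + lo Q r..hi P r + hi Q r}"
  proof (intro set_eqI iffI)
    fix z assume z: "z \<in> {lo P r + lo Q r..hi P r + hi Q r}"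
    define x where "x = max (lo P r) (z - hi Q r)"
    have "x \<in> lev P r" "z - x \<in> lev Q r" using z P Q by (auto simp: x_def)
    then show "z \<in> lev (P \<oplus> Q) r" unfolding lev_add[OF assms] by force
  next
    fix z assume "z \<in> lev (P \<oplus> Q) r"
    then show "z \<in> {lo P r + lo Q r..hi P r + hi Q r}" using P Q by (auto simp: lev_add[OF assms])
  qed
  then show "lo (P \<oplus> Q) r = lo P r + lo Q r" "hi (P \<oplus> Q) r = hi P r + hi Q r"
    using P(2) Q(2) by (auto simp: lo_def[of "P \<oplus> Q"] hi_def[of "P \<oplus> Q"])
qed

lemma endpoints_neg:
  assumes "0 \<le> r" "r \<le> 1"
  shows "lo ((-1) \<odot> P) r = - hi P r" "hi ((-1) \<odot> P) r = - lo P r"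
proof -
  note P = lev_eq[OF assms, of P]
  have "lev ((-1) \<odot> P) r = {- hi P r..- lo P r}"
    unfolding lev_scale[OF assms] P(1) by simp
  then show "lo ((-1) \<odot> P) r = - hi P r" "hi ((-1) \<odot> P) r = - lo P r"
    using P(2) by (auto simp: lo_def[of "(-1) \<odot> P"] hi_def[of "(-1) \<odot> P"])
qed

lemma gH_diff_unique:
  assumes "is_gH_diff P Q R" "is_gH_diff P Q S"
  shows "R = S"
proof (rule fuzzy_eqI')
  fix r :: real assume r: "0 \<le> r" "r \<le> 1"
  have *: "lo P r = lo Q r + lo T r \<and> hi P r = hi Q r + hi T r \<or>
      lo Q r = lo P r - hi T r \<and> hi Q r = hi P r - lo T r" if "is_gH_diff P Q T" for T
  proof -
    from that consider "P = Q \<oplus> T" | "Q = P \<oplus> (-1) \<odot> T" by (auto simp: is_gH_diff_def)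
    then show ?thesis
    proof cases
      case 1 then show ?thesis using endpoints_add[OF r, of Q T] by simp
    next
      case 2 then show ?thesis
        using endpoints_add[OF r, of P "(-1) \<odot> T"] endpoints_neg[OF r, of T] by simp
    qed
  qed
  show "lo R r = lo S r" "hi R r = hi S r"
    using *[OF assms(1)] *[OF assms(2)] lev_eq(2)[OF r, of R] lev_eq(2)[OF r, of S] by linarith+
qed

lemma gH_diff_eqI: "is_gH_diff P Q R \<Longrightarrow> P \<ominus>\<^sub>g\<^sub>H Q = R"
  unfolding gH_diff_def by (blast intro: the_equality gH_diff_unique)

instantiation fuzzy :: metric_space
begin

definition dist_fuzzy :: "fuzzy \<Rightarrow> fuzzy \<Rightarrow> real" where
  "dist_fuzzy P Q = (SUP r\<in>{0..1}. max \<bar>lo P r - lo Q r\<bar> \<bar>hi P r - hi Q r\<bar>)"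

definition uniformity_fuzzy :: "(fuzzy \<times> fuzzy) filter" where
  "uniformity_fuzzy = (INF e\<in>{0<..}. principal {(P, Q). dist P Q < e})"

definition open_fuzzy :: "fuzzy set \<Rightarrow> bool" where
  "open_fuzzy U = (\<forall>P\<in>U. \<forall>\<^sub>F (P', Q) in uniformity. P' = P \<longrightarrow> Q \<in> U)"

lemma dist_fuzzy_upper:
  fixes P Q :: fuzzy
  assumes r: "0 \<le> r" "r \<le> 1"
  shows "max \<bar>lo P r - lo Q r\<bar> \<bar>hi P r - hi Q r\<bar> \<le> dist P Q"
  unfolding dist_fuzzy_def
proof (rule cSUP_upper)
  show "r \<in> {0..1}" using r by simp
  have *: "lo T 0 \<le> lo T s \<and> lo T s \<le> hi T 0 \<and> lo T 0 \<le> hi T s \<and> hi T s \<le> hi T 0"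
    if s: "0 \<le> s" "s \<le> 1" for T s
  proof -
    have "lo T s \<in> lev T s" "hi T s \<in> lev T s" using lev_eq[OF s, of T] by auto
    then have "lo T s \<in> lev T 0" "hi T s \<in> lev T 0" using lev_antimono[of 0 s T] s by auto
    then show ?thesis using lev_eq(1)[of 0 T] by auto
  qed
  show "bdd_above ((\<lambda>r. max \<bar>lo P r - lo Q r\<bar> \<bar>hi P r - hi Q r\<bar>) ` {0..1})"
  proof (rule bdd_aboveI2)
    fix s :: real assume "s \<in> {0..1}"
    then have s: "0 \<le> s" "s \<le> 1" by auto
    show "max \<bar>lo P s - lo Q s\<bar> \<bar>hi P s - hi Q s\<bar>
        \<le> \<bar>hi P 0 - lo Q 0\<bar> + \<bar>hi Q 0 - lo P 0\<bar>"
      using *[OF s, of P] *[OF s, of Q] by linarith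
  qed
qed

lemma dist_fuzzy_least:
  fixes P Q :: fuzzy
  assumes "\<And>r. 0 \<le> r \<Longrightarrow> r \<le> 1 \<Longrightarrow> \<bar>lo P r - lo Q r\<bar> \<le> d"
    and "\<And>r. 0 \<le> r \<Longrightarrow> r \<le> 1 \<Longrightarrow> \<bar>hi P r - hi Q r\<bar> \<le> d"
  shows "dist P Q \<le> d"
  unfolding dist_fuzzy_def using assms by (intro cSUP_least) auto

instance
proof
  fix P Q T :: fuzzy
  show "dist P Q = 0 \<longleftrightarrow> P = Q"
  proof
    assume d: "dist P Q = 0"
    show "P = Q"
    proof (rule fuzzy_eqI')
      fix r :: real assume "0 \<le> r" "r \<le> 1"
      then show "lo P r = lo Q r" "hi P r = hi Q r"
        using dist_fuzzy_upper[of r P Q] d by auto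
    qed
  qed (simp add: dist_fuzzy_def)
  show "dist P Q \<le> dist P T + dist Q T"
  proof (rule dist_fuzzy_least)
    fix r :: real assume "0 \<le> r" "r \<le> 1"
    then show "\<bar>lo P r - lo Q r\<bar> \<le> dist P T + dist Q T" "\<bar>hi P r - hi Q r\<bar> \<le> dist P T + dist Q T"
      using dist_fuzzy_upper[of r P T] dist_fuzzy_upper[of r Q T] by linarith+
  qed
qed (simp_all add: uniformity_fuzzy_def open_fuzzy_def)

end

text \<open>A function \<open>w\<close> on the half line \<open>[0, \<infinity>)\<close> is a total function of which only the values there are
  used, so the increment \<open>\<epsilon>\<close> tends to \<open>0\<close> through those values for which
  \<open>\<tau> + \<epsilon> \<tau>\<^sup>1\<^sup>-\<^sup>\<alpha>\<close> lies in that half line. For \<open>\<tau> > 0\<close> this filter equals \<open>at 0\<close>.\<close>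

definition increments :: "real \<Rightarrow> real \<Rightarrow> real filter" where
  "increments \<alpha> \<tau> = at 0 within {\<epsilon>. \<tau> + \<epsilon> * \<tau> powr (1 - \<alpha>) \<in> {0..}}"

definition has_alpha_gH_derivative :: "real \<Rightarrow> (real \<Rightarrow> fuzzy) \<Rightarrow> fuzzy \<Rightarrow> real \<Rightarrow> bool" where
  "has_alpha_gH_derivative \<alpha> w L \<tau> \<longleftrightarrow>
     (\<forall>\<^sub>F \<epsilon> in increments \<alpha> \<tau>. \<exists>R. is_gH_diff (w (\<tau> + \<epsilon> * \<tau> powr (1 - \<alpha>))) (w \<tau>) R) \<and>
     ((\<lambda>\<epsilon>. (1 / \<epsilon>) \<odot> (w (\<tau> + \<epsilon> * \<tau> powr (1 - \<alpha>)) \<ominus>\<^sub>g\<^sub>H w \<tau>)) \<longlongrightarrow> L) (increments \<alpha> \<tau>)"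

definition alpha_gH_differentiable :: "real \<Rightarrow> (real \<Rightarrow> fuzzy) \<Rightarrow> real \<Rightarrow> bool" where
  "alpha_gH_differentiable \<alpha> w \<tau> \<longleftrightarrow> (\<exists>L. has_alpha_gH_derivative \<alpha> w L \<tau>)"

end

theory Submission
  imports Defs
begin

text \<open>
  The classical argument that differentiability implies continuity carries over as soon as the
  distance from a fuzzy number to the crisp zero is used as its size.  Two facts make this work.
  The size of the gH-difference of \<open>P\<close> and \<open>Q\<close> is the distance of \<open>P\<close> and \<open>Q\<close>, since in both cases
  of the definition the endpoints of the difference are, up to exchanging them, the differences
  of the endpoints (\<open>dist_eq_dist_gH_diff_zero\<close>).  And multiplication by \<open>c\<close> scales distances by
  \<open>\<bar>c\<bar>\<close> (\<open>dist_scale\<close>).  With \<open>\<tau> = \<tau>0 + \<epsilon> \<tau>0\<^sup>1\<^sup>-\<^sup>\<alpha>\<close> the distance of \<open>w \<tau>\<close> and \<open>w \<tau>0\<close> is therefore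
  \<open>\<bar>\<epsilon>\<bar>\<close> times the size of the difference quotient.  The latter converges, so the product tends to
  \<open>0\<close>; as \<open>\<tau>0\<^sup>1\<^sup>-\<^sup>\<alpha>\<close> is positive, every \<open>\<tau>\<close> near \<open>\<tau>0\<close> is reached by a small increment \<open>\<epsilon>\<close>.
\<close>

text \<open>Multiplication by \<open>0\<close> maps every fuzzy number to the crisp zero, so the choice of the
  argument is immaterial.\<close>

definition fuzzy_zero :: fuzzy where
  "fuzzy_zero = 0 \<odot> undefined"

lemma endpoints_scale:
  assumes r: "0 \<le> r" "r \<le> 1"
  shows "lo (c \<odot> P) r = (if 0 \<le> c then c * lo P r else c * hi P r)"
    and "hi (c \<odot> P) r = (if 0 \<le> c then c * hi P r else c * lo P r)"
proof -
  note P = lev_eq[OF r, of P]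
  have "lev (c \<odot> P) r =
      {if 0 \<le> c then c * lo P r else c * hi P r..if 0 \<le> c then c * hi P r else c * lo P r}"
    unfolding lev_scale[OF r] P(1) using P(2) by (auto simp: image_mult_atLeastAtMost_if)
  then show "lo (c \<odot> P) r = (if 0 \<le> c then c * lo P r else c * hi P r)"
    and "hi (c \<odot> P) r = (if 0 \<le> c then c * hi P r else c * lo P r)"
    using P(2) by (simp_all add: lo_def[of "c \<odot> P"] hi_def[of "c \<odot> P"] mult_left_mono
      mult_left_mono_neg)
qed

lemma endpoints_zero:
  assumes "0 \<le> r" "r \<le> 1"
  shows "lo fuzzy_zero r = 0" "hi fuzzy_zero r = 0"
  using assms by (simp_all add: fuzzy_zero_def endpoints_scale)

lemma scale_zero: "c \<odot> fuzzy_zero = fuzzy_zero"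
  by (rule fuzzy_eqI') (simp_all add: endpoints_scale endpoints_zero)

lemma scale_inverse:
  assumes "c \<noteq> 0"
  shows "c \<odot> (1 / c) \<odot> P = P"
  using assms by (intro fuzzy_eqI') (auto simp: endpoints_scale)

lemma dist_scale: "dist (c \<odot> P) (c \<odot> Q) = \<bar>c\<bar> * dist P Q"
proof -
  have le: "dist (c \<odot> P) (c \<odot> Q) \<le> \<bar>c\<bar> * dist P Q" for c P Q
  proof (rule dist_fuzzy_least)
    fix r :: real assume r: "0 \<le> r" "r \<le> 1"
    have "\<bar>c * lo P r - c * lo Q r\<bar> \<le> \<bar>c\<bar> * dist P Q"
      and "\<bar>c * hi P r - c * hi Q r\<bar> \<le> \<bar>c\<bar> * dist P Q"
      using dist_fuzzy_upper[OF r, of P Q]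
      by (auto simp: abs_mult mult_left_mono simp flip: right_diff_distrib)
    then show "\<bar>lo (c \<odot> P) r - lo (c \<odot> Q) r\<bar> \<le> \<bar>c\<bar> * dist P Q"
      and "\<bar>hi (c \<odot> P) r - hi (c \<odot> Q) r\<bar> \<le> \<bar>c\<bar> * dist P Q"
      by (cases "0 \<le> c"; simp add: endpoints_scale r)+
  qed
  show ?thesis
  proof (cases "c = 0")
    case True
    then show ?thesis using le[of c P Q] by simp
  next
    case False
    \<comment> \<open>The reverse inequality is the same bound for the inverse scalar.\<close>
    have ic: "(1 / c) \<odot> c \<odot> T = T" for T
      using scale_inverse[of "1 / c" T] False by simp
    have "dist P Q \<le> \<bar>1 / c\<bar> * dist (c \<odot> P) (c \<odot> Q)"
      using le[of "1 / c" "c \<odot> P" "c \<odot> Q"] by (simp add: ic)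
    then have "\<bar>c\<bar> * dist P Q \<le> dist (c \<odot> P) (c \<odot> Q)"
      using False by (simp add: field_simps)
    then show ?thesis using le[of c P Q] by simp
  qed
qed

text \<open>If \<open>P = Q \<oplus> R\<close>, then \<open>lo P - lo Q = lo R\<close> and \<open>hi P - hi Q = hi R\<close>; in the other case of the
  definition the two right-hand sides are exchanged.  The larger of the two absolute values is
  the same either way.\<close>

lemma dist_eq_dist_gH_diff_zero:
  assumes "is_gH_diff P Q R"
  shows "dist P Q = dist R fuzzy_zero"
proof -
  have "max \<bar>lo P r - lo Q r\<bar> \<bar>hi P r - hi Q r\<bar>
      = max \<bar>lo R r - lo fuzzy_zero r\<bar> \<bar>hi R r - hi fuzzy_zero r\<bar>"
    if "r \<in> {0..1}" for r
    using assms that unfolding is_gH_diff_def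
    by (auto simp: endpoints_add endpoints_neg endpoints_zero max.commute)
  then show ?thesis unfolding dist_fuzzy_def by (intro SUP_cong refl)
qed

lemma dist_eq_abs_times_quotient:
  assumes "is_gH_diff P Q R" "\<epsilon> \<noteq> 0"
  shows "dist P Q = \<bar>\<epsilon>\<bar> * dist ((1 / \<epsilon>) \<odot> (P \<ominus>\<^sub>g\<^sub>H Q)) fuzzy_zero"
  using dist_scale[of \<epsilon> "(1 / \<epsilon>) \<odot> R" fuzzy_zero] assms
  by (simp add: gH_diff_eqI dist_eq_dist_gH_diff_zero scale_inverse scale_zero)

text \<open>The substitution that turns a limit over increments into a limit over points of the half
  line.\<close>

lemma filterlim_increments:
  assumes "0 < \<tau>0"
  shows "filterlim (\<lambda>\<tau>. (\<tau> - \<tau>0) / \<tau>0 powr (1 - \<alpha>)) (increments \<alpha> \<tau>0) (at \<tau>0 within {0..})"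
proof -
  have "((\<lambda>\<tau>. (\<tau> - \<tau>0) / \<tau>0 powr (1 - \<alpha>)) \<longlongrightarrow> (\<tau>0 - \<tau>0) / \<tau>0 powr (1 - \<alpha>)) (at \<tau>0 within {0..})"
    using assms by (intro tendsto_intros) simp
  moreover have "\<forall>\<^sub>F \<tau> in at \<tau>0 within {0..}.
      \<tau>0 + (\<tau> - \<tau>0) / \<tau>0 powr (1 - \<alpha>) * \<tau>0 powr (1 - \<alpha>) \<in> {0..} \<and>
      (\<tau> - \<tau>0) / \<tau>0 powr (1 - \<alpha>) \<noteq> 0"
    using assms by (simp add: eventually_at_filter)
  ultimately show ?thesis
    unfolding increments_def filterlim_at by simp
qed

theorem theorem3p1:
  fixes w :: "real \<Rightarrow> fuzzy" and \<alpha> \<tau>0 :: real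
  assumes "0 < \<alpha>" and "\<alpha> < 1" and "0 < \<tau>0"
    and standing: "\<forall>\<^sub>F \<epsilon> in increments \<alpha> \<tau>0.
      \<exists>R\<in>triangular. is_gH_diff (w (\<tau>0 + \<epsilon> * \<tau>0 powr (1 - \<alpha>))) (w \<tau>0) R"
    and "alpha_gH_differentiable \<alpha> w \<tau>0"
  shows "(w \<longlongrightarrow> w \<tau>0) (at \<tau>0 within {0..})"
proof -
  let ?F = "increments \<alpha> \<tau>0"
  define k where "k = \<tau>0 powr (1 - \<alpha>)"
  have k: "0 < k" using \<open>0 < \<tau>0\<close> by (simp add: k_def)
  define q where "q \<epsilon> = (1 / \<epsilon>) \<odot> (w (\<tau>0 + \<epsilon> * k) \<ominus>\<^sub>g\<^sub>H w \<tau>0)" for \<epsilon>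
  obtain L where ex: "\<forall>\<^sub>F \<epsilon> in ?F. \<exists>R. is_gH_diff (w (\<tau>0 + \<epsilon> * k)) (w \<tau>0) R"
    and lim: "(q \<longlongrightarrow> L) ?F"
    using \<open>alpha_gH_differentiable \<alpha> w \<tau>0\<close>
    unfolding alpha_gH_differentiable_def has_alpha_gH_derivative_def k_def q_def by blast
  have "((\<lambda>\<epsilon>. \<bar>\<epsilon>\<bar> * dist (q \<epsilon>) fuzzy_zero) \<longlongrightarrow> \<bar>0\<bar> * dist L fuzzy_zero) ?F"
    by (intro tendsto_intros lim) (simp add: increments_def)
  moreover have "\<forall>\<^sub>F \<epsilon> in ?F. \<epsilon> \<noteq> 0"
    by (simp add: increments_def eventually_at_filter)
  with ex have "\<forall>\<^sub>F \<epsilon> in ?F. \<bar>\<epsilon>\<bar> * dist (q \<epsilon>) fuzzy_zero = dist (w (\<tau>0 + \<epsilon> * k)) (w \<tau>0)"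
    by eventually_elim (auto simp: q_def dist_eq_abs_times_quotient)
  ultimately have "((\<lambda>\<epsilon>. dist (w (\<tau>0 + \<epsilon> * k)) (w \<tau>0)) \<longlongrightarrow> 0) ?F"
    by (simp add: tendsto_cong)
  from filterlim_compose[OF this filterlim_increments[OF \<open>0 < \<tau>0\<close>]]
  have "((\<lambda>\<tau>. dist (w \<tau>) (w \<tau>0)) \<longlongrightarrow> 0) (at \<tau>0 within {0..})"
    using k by (simp add: k_def)
  then show ?thesis by (rule iffD2[OF tendsto_dist_iff])
qed

end
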